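(* As functions of $n$ (with asymptotics as $n\to\infty$): (a) $g_{(\star,0,0)}(n)=n$; (b) $g_{(0,\star,\star)}(n)\sim n^2/2$; (c) $g_{(\star,0,\star)}(n)\sim n$; (d) $g_{(0,\star,0)}(n)=\Theta(n)$; (e) $g_{(\star,\star,0)}(n)\sim n$; (f) $g_{(0,0,\star)}(n)=\Omega(n)$ and $g_{(0,0,\star)}(n)=O(n^2)$; (g) $g_{(0,0,0)}(n)=\Omega(c^n)$ for a constant $c>1$; (h) $g_{(\star,\star,\star)}(n)=\Omega(c^n)$ for a constant $c>1$.
   Context: Write $[n]=\{1,2,\ldots,n\}$ and let $2^{[n]}$ be the collection of all subsets of $[n]$. For a vector $\alpha=(\alpha_1,\ldots,\alpha_k)\in\{0,\star\}^k$, a collection $\mathcal{F}\subset 2^{[n]}$ satisfies $\alpha$-intersection pattern modulo $3$ if for every $1\le i\le k$ and all (pairwise) distinct $F_1,\ldots,F_i\in\mathcal{F}$: $|F_1\cap\cdots\cap F_i|\equiv 0\pmod 3$ when $\alpha_i=0$, and $|F_1\cap\cdots\cap F_i|\not\equiv 0\pmod 3$ when $\alpha_i=\star$. Let $g_\alpha(n)$ denote the maximum size of a family $\mathcal{F}\subset 2^{[n]}$ satisfying $\alpha$-intersection pattern modulo $3$. For functions $f,g:\mathbb{N}\to\mathbb{R}^+$: $f=O(g)$ means there is $c'>0$ with $f(n)\le c' g(n)$ for all $n$; $f=\Omega(g)$ means $g=O(f)$; $f=\Theta(g)$ means both $f=O(g)$ and $g=O(f)$; and $f\sim g$ means $\lim_{n\to\infty}f(n)/g(n)=1$.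 *)

theory Defs
  imports Complex_Main "HOL-Library.Landau_Symbols"
begin

datatype pattern_symbol = Zero | Star

text \<open>
  A vector \<open>\<alpha>\<close> of length \<open>k\<close> is a list, so the entry \<open>\<alpha>\<^sub>i\<close>, counted from 1, is \<open>\<alpha> ! (i - 1)\<close>.
  A choice of \<open>i\<close> pairwise distinct members of \<open>F\<close> is given as a subfamily of cardinality \<open>i\<close>;
  as \<open>i \<ge> 1\<close>, such a subfamily is finite and nonempty. The condition for \<open>i\<close> is void if \<open>F\<close>
  has fewer than \<open>i\<close> members.
\<close>

definition satisfies_pattern_mod3 :: "pattern_symbol list \<Rightarrow> nat set set \<Rightarrow> bool" where
  "satisfies_pattern_mod3 \<alpha> F \<longleftrightarrow>
     (\<forall>i\<in>{1..length \<alpha>}. \<forall>S. S \<subseteq> F \<and> card S = i \<longrightarrow>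
        (\<alpha> ! (i - 1) = Zero \<longrightarrow> card (\<Inter>S) mod 3 = 0) \<and>
        (\<alpha> ! (i - 1) = Star \<longrightarrow> card (\<Inter>S) mod 3 \<noteq> 0))"

definition max_pattern_size :: "pattern_symbol list \<Rightarrow> nat \<Rightarrow> nat" where
  "max_pattern_size \<alpha> n =
     Max {card F | F. F \<subseteq> Pow {1..n} \<and> satisfies_pattern_mod3 \<alpha> F}"

text \<open>
  The bounds \<open>O\<close>, \<open>\<Omega>\<close> and \<open>\<Theta>\<close> are meant with an inequality valid for every positive integer
  and not merely for all large ones. This is the Landau notation of the library taken
  with respect to the following filter.
\<close>

abbreviation all_pos :: "nat filter" where
  "all_pos \<equiv> principal {1..}"

lemma bigo_all_pos_iff:
  fixes f g :: "nat \<Rightarrow> real"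
  assumes "\<And>n. n \<ge> 1 \<Longrightarrow> f n \<ge> 0" "\<And>n. n \<ge> 1 \<Longrightarrow> g n \<ge> 0"
  shows "f \<in> O[all_pos](g) \<longleftrightarrow> (\<exists>c>0. \<forall>n\<ge>1. f n \<le> c * g n)"
  using assms by (auto simp: bigo_def eventually_principal)

lemma bigomega_all_pos_iff:
  fixes f g :: "nat \<Rightarrow> real"
  shows "f \<in> \<Omega>[all_pos](g) \<longleftrightarrow> g \<in> O[all_pos](f)"
  by (rule bigomega_iff_bigo)

end

theory Submission
  imports Defs "HOL-Computational_Algebra.Primes" "HOL-Library.FuncSet" "HOL-Real_Asymp.Real_Asymp"
begin

text \<open>
  \<^emph>\<open>Upper bounds.\<close> If a family of sets has sizes outside and pairwise intersections inside a set of
  residues \<open>L\<close> modulo a prime, then a polynomial of degree \<open>|L|\<close> in the intersection size turns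
  its matrix of intersection sizes into one that is diagonal modulo the prime with nonzero
  diagonal, and the matrix factors through the subsets of size at most \<open>|L|\<close> of the ground set (for
  \<open>L = {0}\<close>, through the singletons alone).
  Here only \<open>L = {0}\<close> (at most \<open>n\<close> sets, \<open>oddtown_mod3\<close>) and \<open>L = {1, 2}\<close> (at most
  \<open>1 + n + n choose 2\<close> sets, \<open>reverse_oddtown_mod3\<close>) occur. The patterns \<open>(\<star>,0,\<dots>)\<close> and \<open>(0,\<star>,\<dots>)\<close> are
  covered directly. For \<open>(0,\<star>,0)\<close>, \<open>(\<star>,\<star>,0)\<close> and \<open>(0,0,\<star>)\<close>, fix one member \<open>A\<close>: the
  traces \<open>A \<inter> F\<close> of the other members have the second entry as size condition and the third entry
  as condition on pairwise intersections, so one of the two bounds applies to them.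

  \<^emph>\<open>Lower bounds.\<close> The complements of single points of an \<open>m\<close>-set have size \<open>m - 1\<close>, meet pairwise
  in \<open>m - 2\<close> and by threes in \<open>m - 3\<close> points, three successive residues modulo 3. Giving each set
  \<open>q\<close> private further points changes only the first residue. With \<open>m\<close> in a suitable residue class
  this serves the patterns \<open>(\<star>,0,\<star>)\<close> and \<open>(\<star>,\<star>,0)\<close> with \<open>q = 0\<close>, hence with \<open>n - O(1)\<close> sets, and
  \<open>(0,\<star>,0)\<close> with \<open>q = 1\<close> and \<open>(0,0,\<star>)\<close> with \<open>q = 2\<close>. The pattern \<open>(\<star>,0,0)\<close> is satisfied by
  the singletons, \<open>(0,\<star>,\<star>)\<close> by the triples through a fixed point, and the two constant patterns
  by unions of disjoint triples, joined by one fixed point for \<open>(\<star>,\<star>,\<star>)\<close>.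
\<close>

section \<open>Patterns of length three\<close>

definition residue_ok :: "pattern_symbol \<Rightarrow> nat \<Rightarrow> bool" where
  "residue_ok s k \<longleftrightarrow> (s = Zero \<longleftrightarrow> k mod 3 = 0)"

lemma residue_ok_simps [simp]:
  "residue_ok Zero k \<longleftrightarrow> k mod 3 = 0"
  "residue_ok Star k \<longleftrightarrow> k mod 3 \<noteq> 0"
  by (auto simp: residue_ok_def)

lemma satisfies_pattern_triple_iff:
  "satisfies_pattern_mod3 [a, b, c] F \<longleftrightarrow>
     (\<forall>A\<in>F. residue_ok a (card A)) \<and>
     (\<forall>A\<in>F. \<forall>B\<in>F. A \<noteq> B \<longrightarrow> residue_ok b (card (A \<inter> B))) \<and>
     (\<forall>A\<in>F. \<forall>B\<in>F. \<forall>C\<in>F. A \<noteq> B \<and> A \<noteq> C \<and> B \<noteq> C \<longrightarrow> residue_ok c (card (A \<inter> B \<inter> C)))"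
proof -
  have ok: "((s = Zero \<longrightarrow> k mod 3 = 0) \<and> (s = Star \<longrightarrow> k mod 3 \<noteq> 0)) \<longleftrightarrow> residue_ok s k"
    for s and k :: nat
    by (cases s) auto
  have "{1..length [a, b, c]} = {1, 2, 3}"
    by auto
  then have "satisfies_pattern_mod3 [a, b, c] F \<longleftrightarrow>
      (\<forall>S. S \<subseteq> F \<and> card S = 1 \<longrightarrow> residue_ok a (card (\<Inter>S))) \<and>
      (\<forall>S. S \<subseteq> F \<and> card S = 2 \<longrightarrow> residue_ok b (card (\<Inter>S))) \<and>
      (\<forall>S. S \<subseteq> F \<and> card S = 3 \<longrightarrow> residue_ok c (card (\<Inter>S)))"
    unfolding satisfies_pattern_mod3_def ok by simp
  also have "(\<forall>S. S \<subseteq> F \<and> card S = 1 \<longrightarrow> residue_ok a (card (\<Inter>S))) \<longleftrightarrow>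
      (\<forall>A\<in>F. residue_ok a (card A))"
    by (auto simp: card_1_singleton_iff)
  also have "(\<forall>S. S \<subseteq> F \<and> card S = 2 \<longrightarrow> residue_ok b (card (\<Inter>S))) \<longleftrightarrow>
      (\<forall>A\<in>F. \<forall>B\<in>F. A \<noteq> B \<longrightarrow> residue_ok b (card (A \<inter> B)))"
  proof (intro iffI ballI allI impI; (elim conjE)?)
    fix A B
    assume *: "\<forall>S. S \<subseteq> F \<and> card S = 2 \<longrightarrow> residue_ok b (card (\<Inter>S))"
      and "A \<in> F" "B \<in> F" "A \<noteq> B"
    then have "residue_ok b (card (\<Inter>{A, B}))"
      by (intro *[rule_format]) auto
    then show "residue_ok b (card (A \<inter> B))"
      by simp
  next
    fix S
    assume *: "\<forall>A\<in>F. \<forall>B\<in>F. A \<noteq> B \<longrightarrow> residue_ok b (card (A \<inter> B))"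
      and "S \<subseteq> F" "card S = 2"
    then obtain A B where "S = {A, B}" "A \<noteq> B"
      unfolding card_2_iff by blast
    then show "residue_ok b (card (\<Inter>S))"
      using * \<open>S \<subseteq> F\<close> by simp
  qed
  also have "(\<forall>S. S \<subseteq> F \<and> card S = 3 \<longrightarrow> residue_ok c (card (\<Inter>S))) \<longleftrightarrow>
      (\<forall>A\<in>F. \<forall>B\<in>F. \<forall>C\<in>F. A \<noteq> B \<and> A \<noteq> C \<and> B \<noteq> C \<longrightarrow> residue_ok c (card (A \<inter> B \<inter> C)))"
  proof (intro iffI ballI allI impI; (elim conjE)?)
    fix A B C
    assume *: "\<forall>S. S \<subseteq> F \<and> card S = 3 \<longrightarrow> residue_ok c (card (\<Inter>S))"
      and "A \<in> F" "B \<in> F" "C \<in> F" "A \<noteq> B" "A \<noteq> C" "B \<noteq> C"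
    then have "residue_ok c (card (\<Inter>{A, B, C}))"
      by (intro *[rule_format]) auto
    then show "residue_ok c (card (A \<inter> B \<inter> C))"
      by (simp add: Int_assoc)
  next
    fix S
    assume *: "\<forall>A\<in>F. \<forall>B\<in>F. \<forall>C\<in>F. A \<noteq> B \<and> A \<noteq> C \<and> B \<noteq> C \<longrightarrow>
        residue_ok c (card (A \<inter> B \<inter> C))"
      and "S \<subseteq> F" "card S = 3"
    then obtain A B C where S: "S = {A, B, C}" "A \<noteq> B" "A \<noteq> C" "B \<noteq> C"
      unfolding card_3_iff by blast
    then have "residue_ok c (card (A \<inter> B \<inter> C))"
      using * \<open>S \<subseteq> F\<close> by auto
    then show "residue_ok c (card (\<Inter>S))"
      by (simp add: S Int_assoc)
  qed
  finally show ?thesis .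
qed

lemma finite_pattern_cards:
  "finite {card F | F. F \<subseteq> Pow {1..n::nat} \<and> satisfies_pattern_mod3 \<alpha> F}"
proof -
  have "{card F | F. F \<subseteq> Pow {1..n} \<and> satisfies_pattern_mod3 \<alpha> F} \<subseteq> card ` Pow (Pow {1..n})"
    by auto
  then show ?thesis
    by (rule finite_subset) simp
qed

lemma max_pattern_size_ge:
  assumes "F \<subseteq> Pow {1..n}" "satisfies_pattern_mod3 \<alpha> F"
  shows "card F \<le> max_pattern_size \<alpha> n"
  unfolding max_pattern_size_def using assms by (intro Max_ge finite_pattern_cards) auto

lemma max_pattern_size_le:
  assumes "\<And>F. F \<subseteq> Pow {1..n} \<Longrightarrow> satisfies_pattern_mod3 \<alpha> F \<Longrightarrow> card F \<le> k"
  shows "max_pattern_size \<alpha> n \<le> k"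
proof -
  \<comment> \<open>the empty family satisfies every pattern, so the maximum is over a nonempty set\<close>
  have "satisfies_pattern_mod3 \<alpha> {}"
    by (auto simp: satisfies_pattern_mod3_def)
  then have "{card F | F. F \<subseteq> Pow {1..n} \<and> satisfies_pattern_mod3 \<alpha> F} \<noteq> {}"
    by blast
  then show ?thesis
    unfolding max_pattern_size_def using assms finite_pattern_cards by (subst Max_le_iff) auto
qed

section \<open>Upper bounds by linear algebra modulo 3\<close>

text \<open>
  The vectors \<open>u i\<close> are linearly independent modulo \<open>p\<close>, because the \<open>v j\<close> read off the
  coefficients of a linear combination. The bound then follows by counting: the \<open>p ^ card I\<close>
  combinations are distinct among the \<open>p ^ card D\<close> vectors.
\<close>

lemma biorthogonal_mod_prime_bound:
  fixes p :: int and u v :: "'i \<Rightarrow> 'd \<Rightarrow> int"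
  assumes p: "prime p" and fin: "finite I" "finite D"
    and off: "\<And>i j. i \<in> I \<Longrightarrow> j \<in> I \<Longrightarrow> i \<noteq> j \<Longrightarrow> p dvd (\<Sum>d\<in>D. u i d * v j d)"
    and diag: "\<And>i. i \<in> I \<Longrightarrow> \<not> p dvd (\<Sum>d\<in>D. u i d * v i d)"
  shows "card I \<le> card D"
proof -
  have p1: "p > 1"
    using p by (rule prime_gt_1_int)
  define comb where "comb c = (\<lambda>d\<in>D. (\<Sum>i\<in>I. c i * u i d) mod p)" for c
  have "inj_on comb (I \<rightarrow>\<^sub>E {0..<p})"
  proof (rule inj_onI)
    fix c c'
    assume c: "c \<in> I \<rightarrow>\<^sub>E {0..<p}" and c': "c' \<in> I \<rightarrow>\<^sub>E {0..<p}" and eq: "comb c = comb c'"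
    have "c j = c' j" if j: "j \<in> I" for j
    proof -
      define g where "g i = (\<Sum>d\<in>D. u i d * v j d)" for i
      have agree: "p dvd (\<Sum>i\<in>I. (c i - c' i) * u i d)" if "d \<in> D" for d
        using fun_cong[OF eq, of d] that
        by (simp add: comb_def mod_eq_dvd_iff left_diff_distrib sum_subtractf)
      have "p dvd (\<Sum>d\<in>D. (\<Sum>i\<in>I. (c i - c' i) * u i d) * v j d)"
        by (rule dvd_sum, rule dvd_mult2, rule agree)
      also have "\<dots> = (\<Sum>i\<in>I. (c i - c' i) * g i)"
        unfolding g_def sum_distrib_left sum_distrib_right
        by (subst sum.swap) (simp add: mult.assoc)
      also have "\<dots> = (c j - c' j) * g j + (\<Sum>i\<in>I - {j}. (c i - c' i) * g i)"
        using fin j by (simp add: sum.remove)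
      finally have "p dvd (c j - c' j) * g j + (\<Sum>i\<in>I - {j}. (c i - c' i) * g i)" .
      moreover have "p dvd (\<Sum>i\<in>I - {j}. (c i - c' i) * g i)"
        using off j by (intro dvd_sum dvd_mult) (auto simp: g_def)
      ultimately have "p dvd (c j - c' j) * g j"
        by (simp add: dvd_add_left_iff)
      then have "p dvd c j - c' j"
        using diag[OF j] p by (auto simp: g_def prime_dvd_mult_iff)
      then have "c j mod p = c' j mod p"
        by (simp add: mod_eq_dvd_iff)
      then show ?thesis
        using PiE_mem[OF c j] PiE_mem[OF c' j] by simp
    qed
    then show "c = c'"
      by (rule PiE_ext[OF c c'])
  qed
  moreover have "comb ` (I \<rightarrow>\<^sub>E {0..<p}) \<subseteq> D \<rightarrow>\<^sub>E {0..<p}"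
    using p1 by (auto simp: comb_def)
  ultimately have "card (I \<rightarrow>\<^sub>E {0..<p}) \<le> card (D \<rightarrow>\<^sub>E {0..<p})"
    using fin by (intro card_inj_on_le) (auto intro: finite_PiE)
  then have "nat p ^ card I \<le> nat p ^ card D"
    using fin by (simp add: card_PiE)
  then show ?thesis
    using p1 by (simp add: power_increasing_iff)
qed

text \<open>
  The pairing is the scalar product of indicator vectors.
\<close>

lemma oddtown_mod3:
  fixes X :: "'i \<Rightarrow> 'a set"
  assumes fin: "finite I" "finite V" and sub: "\<And>i. i \<in> I \<Longrightarrow> X i \<subseteq> V"
    and size: "\<And>i. i \<in> I \<Longrightarrow> card (X i) mod 3 \<noteq> 0"
    and pair: "\<And>i j. i \<in> I \<Longrightarrow> j \<in> I \<Longrightarrow> i \<noteq> j \<Longrightarrow> card (X i \<inter> X j) mod 3 = 0"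
  shows "card I \<le> card V"
proof -
  define u :: "'i \<Rightarrow> 'a \<Rightarrow> int" where "u i d = of_bool (d \<in> X i)" for i d
  have u: "(\<Sum>d\<in>V. u i d * u j d) = int (card (X i \<inter> X j))" if "i \<in> I" for i j
  proof -
    have "V \<inter> {d. d \<in> X i \<and> d \<in> X j} = X i \<inter> X j"
      using sub[OF that] by auto
    then show ?thesis
      using fin by (simp add: u_def flip: of_bool_conj)
  qed
  have dvd: "3 dvd int k \<longleftrightarrow> k mod 3 = 0" for k
    by presburger
  show ?thesis
    by (rule biorthogonal_mod_prime_bound[of 3 I V u u])
       (use fin size pair in \<open>simp_all add: u dvd\<close>)
qed

text \<open>
  With \<open>c\<close> the size of an intersection, the integer \<open>1 - c\<^sup>2\<close> is divisible by 3 exactly if \<open>c\<close> is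
  not, and it equals \<open>1 - c - 2 (c choose 2)\<close>: a weighted count of the subsets of size at most 2
  of the intersection, and thus a scalar product of vectors indexed by the small subsets of the
  ground set.
\<close>

lemma reverse_oddtown_mod3:
  fixes X :: "'i \<Rightarrow> 'a set"
  assumes fin: "finite I" "finite V" and sub: "\<And>i. i \<in> I \<Longrightarrow> X i \<subseteq> V"
    and size: "\<And>i. i \<in> I \<Longrightarrow> card (X i) mod 3 = 0"
    and pair: "\<And>i j. i \<in> I \<Longrightarrow> j \<in> I \<Longrightarrow> i \<noteq> j \<Longrightarrow> card (X i \<inter> X j) mod 3 \<noteq> 0"
  shows "card I \<le> 1 + card V + (card V choose 2)"
proof -
  define small where "small W = {T. T \<subseteq> W \<and> card T \<le> 2}" for W :: "'a set"
  have small_sum: "(\<Sum>T\<in>small W. h (card T)) =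
      h 0 + of_nat (card W) * h 1 + of_nat (card W choose 2) * h 2"
    if W: "finite W" for W and h :: "nat \<Rightarrow> int"
  proof -
    have "(\<Sum>T\<in>small W. h (card T)) =
        (\<Sum>k\<in>{0, 1, 2}. \<Sum>T\<in>{T \<in> small W. card T = k}. h (card T))"
      by (rule sum.group[symmetric]) (use W in \<open>auto simp: small_def\<close>)
    also have "\<dots> = (\<Sum>k\<in>{0, 1, 2}. of_nat (card W choose k) * h k)"
    proof (rule sum.cong)
      fix k :: nat assume "k \<in> {0, 1, 2}"
      then have "{T \<in> small W. card T = k} = {T. T \<subseteq> W \<and> card T = k}"
        by (auto simp: small_def)
      then show "(\<Sum>T\<in>{T \<in> small W. card T = k}. h (card T)) = of_nat (card W choose k) * h k"
        using n_subsets[OF W, of k] by simp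
    qed simp
    finally show ?thesis
      by simp
  qed
  have fin_small: "finite (small W)" if "finite W" for W
    using that by (simp add: small_def)
  define w :: "nat \<Rightarrow> int" where "w k = (if k = 0 then 1 else if k = 1 then -1 else -2)" for k
  define u :: "'i \<Rightarrow> 'a set \<Rightarrow> int" where "u i T = of_bool (T \<subseteq> X i)" for i T
  define v :: "'i \<Rightarrow> 'a set \<Rightarrow> int" where "v i T = of_bool (T \<subseteq> X i) * w (card T)" for i T
  have uv: "(\<Sum>T\<in>small V. u i T * v j T) = 1 - (int (card (X i \<inter> X j)))\<^sup>2"
    if "i \<in> I" for i j
  proof -
    define c where "c = card (X i \<inter> X j)"
    have finX: "finite (X i \<inter> X j)"
      using sub[OF that] fin finite_subset by blast
    have "(\<Sum>T\<in>small V. u i T * v j T) = (\<Sum>T\<in>small (X i \<inter> X j). w (card T))"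
      by (rule sum.mono_neutral_cong_right)
         (use fin fin_small sub[OF that] in \<open>auto simp: small_def u_def v_def\<close>)
    also have "\<dots> = 1 - int c - 2 * int (c choose 2)"
      using small_sum[OF finX, of w] by (simp add: w_def c_def)
    also have "\<dots> = 1 - (int c)\<^sup>2"
    proof -
      have "2 * (c choose 2) = c * (c - 1)"
        by (cases c) (simp_all add: choose_two)
      then have "2 * int (c choose 2) = int (c * (c - 1))"
        by (metis of_nat_mult of_nat_numeral)
      then show ?thesis
        by (cases c) (simp_all add: power2_eq_square algebra_simps)
    qed
    finally show ?thesis
      by (simp add: c_def)
  qed
  have p3: "prime (3 :: int)"
    by simp
  have dvd: "3 dvd 1 - (int k)\<^sup>2 \<longleftrightarrow> k mod 3 \<noteq> 0" for k
  proof -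
    have "1 - (int k)\<^sup>2 = - ((int k - 1) * (int k + 1))"
      by (simp add: power2_eq_square algebra_simps)
    then have "3 dvd 1 - (int k)\<^sup>2 \<longleftrightarrow> 3 dvd int k - 1 \<or> 3 dvd int k + 1"
      by (simp only: dvd_minus_iff prime_dvd_mult_iff[OF p3])
    then show ?thesis
      by presburger
  qed
  have "card I \<le> card (small V)"
    by (rule biorthogonal_mod_prime_bound[of 3 I "small V" u v])
       (use fin fin_small size pair in \<open>simp_all add: uv dvd\<close>)
  also have "int (card (small V)) = int (1 + card V + (card V choose 2))"
    using small_sum[OF fin(2), of "\<lambda>_. 1"] by simp
  then have "card (small V) = 1 + card V + (card V choose 2)"
    by (simp only: of_nat_eq_iff)
  finally show ?thesis .
qed

lemma max_pattern_size_Star_Zero_le: "max_pattern_size [Star, Zero, c] n \<le> n"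
proof (rule max_pattern_size_le)
  fix F assume F: "F \<subseteq> Pow {1..n}" "satisfies_pattern_mod3 [Star, Zero, c] F"
  have "card F \<le> card {1..n}"
    by (rule oddtown_mod3[of F _ "\<lambda>A. A"])
       (use F finite_subset[OF F(1)] in \<open>auto simp: satisfies_pattern_triple_iff\<close>)
  then show "card F \<le> n"
    by simp
qed

lemma max_pattern_size_Zero_Star_le:
  "max_pattern_size [Zero, Star, c] n \<le> 1 + n + (n choose 2)"
proof (rule max_pattern_size_le)
  fix F assume F: "F \<subseteq> Pow {1..n}" "satisfies_pattern_mod3 [Zero, Star, c] F"
  have "card F \<le> 1 + card {1..n} + (card {1..n} choose 2)"
    by (rule reverse_oddtown_mod3[of F _ "\<lambda>A. A"])
       (use F finite_subset[OF F(1)] in \<open>auto simp: satisfies_pattern_triple_iff\<close>)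
  then show "card F \<le> 1 + n + (n choose 2)"
    by simp
qed

text \<open>
  Traces on a fixed member shift the pattern by one entry. The traces are indexed by the members
  of the family, so that their distinctness is not an issue.
\<close>

lemma max_pattern_size_le_by_traces:
  assumes traces: "\<And>I X. finite I \<Longrightarrow> (\<And>B. B \<in> I \<Longrightarrow> X B \<subseteq> {1..n}) \<Longrightarrow>
      (\<And>B. B \<in> I \<Longrightarrow> residue_ok b (card (X B))) \<Longrightarrow>
      (\<And>B C. B \<in> I \<Longrightarrow> C \<in> I \<Longrightarrow> B \<noteq> C \<Longrightarrow> residue_ok c (card (X B \<inter> X C))) \<Longrightarrow>
      card (I :: nat set set) \<le> k"
  shows "max_pattern_size [a, b, c] n \<le> Suc k"
proof (rule max_pattern_size_le)
  fix F assume F: "F \<subseteq> Pow {1..n}" "satisfies_pattern_mod3 [a, b, c] F"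
  have finF: "finite F"
    by (rule finite_subset[OF F(1)]) simp
  show "card F \<le> Suc k"
  proof (cases "F = {}")
    case False
    then obtain A where A: "A \<in> F"
      by blast
    have "card (F - {A}) \<le> k"
    proof (rule traces[of _ "\<lambda>B. A \<inter> B"])
      fix B C assume "B \<in> F - {A}" "C \<in> F - {A}" "B \<noteq> C"
      then have "residue_ok c (card (A \<inter> B \<inter> C))"
        using F(2) A unfolding satisfies_pattern_triple_iff by blast
      moreover have "A \<inter> B \<inter> (A \<inter> C) = A \<inter> B \<inter> C"
        by blast
      ultimately show "residue_ok c (card (A \<inter> B \<inter> (A \<inter> C)))"
        by simp
    qed (use F A finF in \<open>auto simp: satisfies_pattern_triple_iff\<close>)
    then show ?thesis
      using A finF by (simp add: card_Diff_singleton)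
  qed simp
qed

lemma max_pattern_size_traces_Star_Zero_le: "max_pattern_size [a, Star, Zero] n \<le> Suc n"
proof (rule max_pattern_size_le_by_traces)
  fix I :: "nat set set" and X
  assume "finite I" "\<And>B. B \<in> I \<Longrightarrow> X B \<subseteq> {1..n}"
    "\<And>B. B \<in> I \<Longrightarrow> residue_ok Star (card (X B))"
    "\<And>B C. B \<in> I \<Longrightarrow> C \<in> I \<Longrightarrow> B \<noteq> C \<Longrightarrow> residue_ok Zero (card (X B \<inter> X C))"
  then show "card I \<le> n"
    using oddtown_mod3[of I "{1..n}" X] by simp
qed

lemma max_pattern_size_traces_Zero_Star_le:
  "max_pattern_size [a, Zero, Star] n \<le> Suc (1 + n + (n choose 2))"
proof (rule max_pattern_size_le_by_traces)
  fix I :: "nat set set" and X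
  assume "finite I" "\<And>B. B \<in> I \<Longrightarrow> X B \<subseteq> {1..n}"
    "\<And>B. B \<in> I \<Longrightarrow> residue_ok Zero (card (X B))"
    "\<And>B C. B \<in> I \<Longrightarrow> C \<in> I \<Longrightarrow> B \<noteq> C \<Longrightarrow> residue_ok Star (card (X B \<inter> X C))"
  then show "card I \<le> 1 + n + (n choose 2)"
    using reverse_oddtown_mod3[of I "{1..n}" X] by simp
qed

section \<open>Constructions\<close>

lemma max_pattern_size_Zero_pos: "1 \<le> max_pattern_size [Zero, b, c] n"
  using max_pattern_size_ge[of "{{}}" n "[Zero, b, c]"]
  by (simp add: satisfies_pattern_triple_iff)

lemma max_pattern_size_singletons: "n \<le> max_pattern_size [Star, Zero, Zero] n"
proof -
  have "card ((\<lambda>i. {i}) ` {1..n}) \<le> max_pattern_size [Star, Zero, Zero] n"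
    by (rule max_pattern_size_ge) (auto simp: satisfies_pattern_triple_iff)
  then show ?thesis
    by (simp add: card_image)
qed

text \<open>
  The point common to all triples keeps the intersections of distinct triples at sizes 1 and 2.
\<close>

lemma max_pattern_size_triples_through_point:
  "(n - 1) choose 2 \<le> max_pattern_size [Zero, Star, Star] n"
proof -
  define P where "P = {T. T \<subseteq> {2..n} \<and> card T = 2}"
  have P: "finite T" "card T = 2" "1 \<notin> T" if "T \<in> P" for T
    using that finite_subset[of T "{2..n}"] by (auto simp: P_def)
  have inj: "inj_on (insert 1) P"
    using P(3) by (intro inj_onI) (metis insert_ident)
  have lt: "card (T \<inter> W) < 2" if "T \<in> P" "T' \<in> P" "T \<noteq> T'" "W \<subseteq> T'" for T T' W
  proof (rule ccontr)
    assume "\<not> card (T \<inter> W) < 2"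
    moreover have "card (T \<inter> W) \<le> card (T \<inter> T')"
      using P(1)[OF that(1)] that(4) by (intro card_mono) blast+
    moreover have "card (T \<inter> T') \<le> card T"
      using P(1)[OF that(1)] by (intro card_mono) auto
    ultimately have "card (T \<inter> T') = 2"
      using P(2)[OF that(1)] by simp
    then have "T \<inter> T' = T" "T \<inter> T' = T'"
      using card_subset_eq[OF P(1)[OF that(1)], of "T \<inter> T'"] P(2)[OF that(1)]
        card_subset_eq[OF P(1)[OF that(2)], of "T \<inter> T'"] P(2)[OF that(2)]
      by auto
    then show False
      using that(3) by simp
  qed
  have star: "residue_ok Star (card (insert 1 (T \<inter> W)))"
    if "T \<in> P" "T' \<in> P" "T \<noteq> T'" "W \<subseteq> T'" for T T' W
  proof -
    have "card (insert 1 (T \<inter> W)) = Suc (card (T \<inter> W))"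
      using P(1,3)[OF that(1)] by (intro card_insert_disjoint) auto
    then show ?thesis
      using lt[OF that] by simp
  qed
  have "satisfies_pattern_mod3 [Zero, Star, Star] (insert 1 ` P)"
    unfolding satisfies_pattern_triple_iff
  proof (intro conjI ballI impI; (elim imageE conjE)?; hypsubst?)
    fix T assume "T \<in> P"
    then show "residue_ok Zero (card (insert 1 T))"
      using P[of T] by simp
  next
    fix T T' assume "T \<in> P" "T' \<in> P" "insert 1 T \<noteq> insert 1 T'"
    then have "residue_ok Star (card (insert 1 (T \<inter> T')))"
      by (intro star[of T T' T']; blast)
    then show "residue_ok Star (card (insert 1 T \<inter> insert 1 T'))"
      by (simp only: insert_inter_insert)
  next
    fix T T' T'' assume "T \<in> P" "T' \<in> P" "T'' \<in> P" "insert 1 T \<noteq> insert 1 T'"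
    then have "residue_ok Star (card (insert 1 (T \<inter> (T' \<inter> T''))))"
      by (intro star[of T T' "T' \<inter> T''"]; blast)
    then show "residue_ok Star (card (insert 1 T \<inter> insert 1 T' \<inter> insert 1 T''))"
      by (simp only: insert_inter_insert Int_assoc)
  qed
  moreover have "insert 1 ` P \<subseteq> Pow {1..n}"
  proof -
    have "insert 1 T \<subseteq> {1..n}" if "T \<in> P" for T
    proof -
      have "T \<subseteq> {2..n}" "T \<noteq> {}"
        using P(2)[OF that] that by (auto simp: P_def)
      then obtain x where "x \<in> {2..n}"
        by blast
      then show ?thesis
        using \<open>T \<subseteq> {2..n}\<close> by auto
    qed
    then show ?thesis
      by blast
  qed
  ultimately have "card (insert 1 ` P) \<le> max_pattern_size [Zero, Star, Star] n"
    by (rule max_pattern_size_ge[rotated])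
  moreover have "card P = (n - 1) choose 2"
    unfolding P_def by (subst n_subsets) auto
  ultimately show ?thesis
    using inj by (simp add: card_image)
qed

text \<open>
  The sets are the complements of the points of \<open>{1..m}\<close>, each with \<open>q\<close> private points above \<open>m\<close>.
  The three residue conditions are those of \<open>m - 1 + q\<close>, \<open>m - 2\<close> and \<open>m - 3\<close>, written without
  subtraction.
\<close>

lemma max_pattern_size_point_complements:
  assumes n: "m * (q + 1) \<le> n"
    and res: "residue_ok a (m + q + 2)" "residue_ok b (m + 1)" "residue_ok c m"
  shows "m \<le> max_pattern_size [a, b, c] n"
proof -
  define Q where "Q i = {m + q * (i - 1)<..m + q * i}" for i
  define X where "X i = ({1..m} - {i}) \<union> Q i" for i
  have Q_disj: "Q i \<inter> Q j = {}" if "i \<in> {1..m}" "j \<in> {1..m}" "i \<noteq> j" for i j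
  proof -
    have *: "Q i \<inter> Q j = {}" if "i < j" for i j
    proof -
      have "q * i \<le> q * (j - 1)"
        using that by (intro mult_le_mono2) auto
      then show ?thesis
        by (auto simp: Q_def)
    qed
    show ?thesis
      using *[of i j] *[of j i] that by (cases "i < j") auto
  qed
  have Q_card: "card (Q i) = q" if "i \<in> {1..m}" for i
    using that by (cases i) (auto simp: Q_def)
  have Q_low: "x > m" if "x \<in> Q i" for i x
    using that by (auto simp: Q_def)
  have Q_up: "x \<le> n" if "x \<in> Q i" "i \<in> {1..m}" for i x
  proof -
    have "m + q * i \<le> m + q * m"
      using that by simp
    moreover have "m + q * m = m * (q + 1)"
      by simp
    moreover have "x \<le> m + q * i"
      using that by (simp add: Q_def)
    ultimately show ?thesis
      using n by linarith
  qed
  have inj: "inj_on X {1..m}"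
  proof (rule inj_onI, rule ccontr)
    fix i j assume "i \<in> {1..m}" "j \<in> {1..m}" "X i = X j" "i \<noteq> j"
    moreover from this have "i \<in> X j"
      by (simp add: X_def)
    moreover have "i \<notin> X i"
      using Q_low[of i i] \<open>i \<in> {1..m}\<close> by (auto simp: X_def)
    ultimately show False
      by simp
  qed
  \<comment> \<open>adding 3 makes the truncated differences below exact\<close>
  have mod_eq: "residue_ok s k \<longleftrightarrow> residue_ok s (k + 3)" for s k
    by (cases s) auto
  have card1: "card (X i) + 3 = m + q + 2" if "i \<in> {1..m}" for i
  proof -
    have "card (X i) = card ({1..m} - {i}) + card (Q i)"
      unfolding X_def using Q_low by (intro card_Un_disjoint) (auto simp: Q_def)
    then show ?thesis
      using that Q_card[OF that] by auto
  qed
  have card2: "card (X i \<inter> X j) + 3 = m + 1"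
    if ij: "i \<in> {1..m}" "j \<in> {1..m}" "i \<noteq> j" for i j
  proof -
    have "X i \<inter> X j = {1..m} - {i, j}"
      using Q_disj[OF that] Q_low by (fastforce simp: X_def)
    moreover have "card ({1..m} - {i, j}) = m - card {i, j}"
      using ij by (subst card_Diff_subset) auto
    moreover have "card {i, j} \<le> card {1..m}"
      using ij by (intro card_mono) auto
    ultimately show ?thesis
      using ij by auto
  qed
  have card3: "card (X i \<inter> X j \<inter> X k) + 3 = m"
    if ijk: "i \<in> {1..m}" "j \<in> {1..m}" "k \<in> {1..m}" "i \<noteq> j" "i \<noteq> k" "j \<noteq> k" for i j k
  proof -
    have "X i \<inter> X j \<inter> X k = {1..m} - {i, j, k}"
      using Q_disj[of i j] ijk Q_low by (fastforce simp: X_def)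
    moreover have "card ({1..m} - {i, j, k}) = m - card {i, j, k}"
      using ijk by (subst card_Diff_subset) auto
    moreover have "card {i, j, k} \<le> card {1..m}"
      using ijk by (intro card_mono) auto
    ultimately show ?thesis
      using ijk by auto
  qed
  have "satisfies_pattern_mod3 [a, b, c] (X ` {1..m})"
    unfolding satisfies_pattern_triple_iff
  proof (intro conjI ballI impI; (elim imageE conjE)?; hypsubst?)
    fix i assume "i \<in> {1..m}"
    then show "residue_ok a (card (X i))"
      using res(1) by (simp only: mod_eq[of _ "card (X i)"] card1)
  next
    fix i j assume "i \<in> {1..m}" "j \<in> {1..m}" "X i \<noteq> X j"
    then have "card (X i \<inter> X j) + 3 = m + 1"
      by (intro card2) auto
    then show "residue_ok b (card (X i \<inter> X j))"
      using res(2) by (simp only: mod_eq[of _ "card (X i \<inter> X j)"])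
  next
    fix i j k
    assume "i \<in> {1..m}" "j \<in> {1..m}" "k \<in> {1..m}" "X i \<noteq> X j" "X i \<noteq> X k" "X j \<noteq> X k"
    then have "card (X i \<inter> X j \<inter> X k) + 3 = m"
      by (intro card3) auto
    then show "residue_ok c (card (X i \<inter> X j \<inter> X k))"
      using res(3) by (simp only: mod_eq[of _ "card (X i \<inter> X j \<inter> X k)"])
  qed
  moreover have "X ` {1..m} \<subseteq> Pow {1..n}"
  proof -
    have "x \<in> {1..n}" if "i \<in> {1..m}" "x \<in> X i" for i x
    proof (cases "x \<in> Q i")
      case True
      then show ?thesis
        using Q_low[OF True] Q_up[OF True that(1)] by simp
    next
      case False
      have "m \<le> n"
        using n by simp
      then show ?thesis
        using False that by (auto simp: X_def)
    qed
    then show ?thesis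
      by blast
  qed
  ultimately have "card (X ` {1..m}) \<le> max_pattern_size [a, b, c] n"
    by (rule max_pattern_size_ge[rotated])
  then show ?thesis
    using inj by (simp add: card_image)
qed

text \<open>
  Every intersection of the sets used consists of \<open>{1..b}\<close> and some of \<open>m\<close> disjoint triples, so
  all of them have size \<open>b\<close> modulo 3.
\<close>

lemma max_pattern_size_unions_of_triples:
  assumes n: "b + 3 * m \<le> n" and b: "residue_ok s b"
  shows "2 ^ m \<le> max_pattern_size [s, s, s] n"
proof -
  define f where "f = (\<lambda>(a, r). b + 3 * a + r :: nat)"
  define G where "G A = {1..b} \<union> f ` (A \<times> {1..3})" for A
  have f_inj: "inj_on f (UNIV \<times> {1..3})"
    unfolding inj_on_def f_def by auto presburger+
  have low: "{1..b} \<inter> f ` (A \<times> {1..3}) = {}" for A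
    by (auto simp: f_def)
  have G_Int: "G A \<inter> G B = G (A \<inter> B)" for A B
  proof -
    have "f ` (A \<times> {1..3}) \<inter> f ` (B \<times> {1..3}) = f ` (A \<times> {1..3} \<inter> B \<times> {1..3})"
      by (rule inj_on_image_Int[OF f_inj, symmetric]) auto
    also have "A \<times> {1..3} \<inter> B \<times> {1..3} = (A \<inter> B) \<times> {1..3::nat}"
      by auto
    finally show ?thesis
      using low[of A] low[of B] unfolding G_def by blast
  qed
  have G_card: "card (G A) = b + 3 * card A" if "finite A" for A
  proof -
    have "card (G A) = card {1..b} + card (f ` (A \<times> {1..3}))"
      unfolding G_def using that by (intro card_Un_disjoint low) simp_all
    also have "card (f ` (A \<times> {1..3})) = card (A \<times> {1..3::nat})"
      by (intro card_image inj_on_subset[OF f_inj]) auto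
    finally show ?thesis
      by (simp add: card_cartesian_product)
  qed
  have ok: "residue_ok s (card (G A))" if "A \<subseteq> {..<m}" for A
    using b G_card[OF finite_subset[OF that]] by (cases s) auto
  have "inj_on G (Pow {..<m})"
  proof (rule inj_onI)
    fix A B assume AB: "A \<in> Pow {..<m}" "B \<in> Pow {..<m}" "G A = G B"
    then have fin: "finite A" "finite B"
      by (auto intro: finite_subset[OF _ finite_lessThan])
    have "G (A \<inter> B) = G A" "G (A \<inter> B) = G B"
      using G_Int[of A B] AB by auto
    then have "card (A \<inter> B) = card A" "card (A \<inter> B) = card B"
      using G_card[of "A \<inter> B"] G_card[of A] G_card[of B] fin by auto
    then have "A \<inter> B = A" "A \<inter> B = B"
      using fin card_subset_eq[of A "A \<inter> B"] card_subset_eq[of B "A \<inter> B"] by blast+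
    then show "A = B"
      by simp
  qed
  then have "2 ^ m = card (G ` Pow {..<m})"
    by (simp add: card_image card_Pow)
  also have "\<dots> \<le> max_pattern_size [s, s, s] n"
  proof (rule max_pattern_size_ge)
    show "G ` Pow {..<m} \<subseteq> Pow {1..n}"
      using n by (fastforce simp: G_def f_def)
    show "satisfies_pattern_mod3 [s, s, s] (G ` Pow {..<m})"
      unfolding satisfies_pattern_triple_iff by (auto simp: G_Int intro!: ok)
  qed
  finally show ?thesis .
qed

section \<open>Asymptotics\<close>

text \<open>
  The base is the cube root of 2, as every three points of the ground set double the family.
\<close>

lemma max_pattern_size_constant_exponential:
  assumes b: "b \<le> 1" "residue_ok s b"
  shows "\<exists>c::real. c > 1 \<and>
    (\<lambda>n. real (max_pattern_size [s, s, s] n)) \<in> \<Omega>[all_pos](\<lambda>n. c ^ n)"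
proof (intro exI conjI)
  let ?c = "root 3 2 :: real"
  show c1: "?c > 1"
    by simp
  have "?c ^ n \<le> 2 * real (max_pattern_size [s, s, s] n)" if "n \<ge> 1" for n
  proof -
    define m where "m = (n - b) div 3"
    have m: "b + 3 * m \<le> n" "n \<le> 3 * (m + 1)"
      using that b unfolding m_def by presburger+
    have "?c ^ n \<le> ?c ^ (3 * (m + 1))"
      using m c1 by (intro power_increasing) auto
    also have "\<dots> = 2 ^ (m + 1)"
      by (simp add: power_mult del: power_Suc mult_Suc_right)
    also have "\<dots> = 2 * real (2 ^ m)"
      by simp
    also have "\<dots> \<le> 2 * real (max_pattern_size [s, s, s] n)"
      using max_pattern_size_unions_of_triples[OF m(1) b(2)]
      by (simp only: of_nat_le_iff mult_le_cancel_left_pos zero_less_numeral)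
    finally show ?thesis .
  qed
  then show "(\<lambda>n. real (max_pattern_size [s, s, s] n)) \<in> \<Omega>[all_pos](\<lambda>n. ?c ^ n)"
    unfolding bigomega_iff_bigo
    by (intro bigoI[of _ 2]) (auto simp: eventually_principal)
qed

lemma asymp_equiv_identity:
  fixes f :: "nat \<Rightarrow> nat"
  assumes "\<And>n. n \<le> f n + 2" "\<And>n. f n \<le> Suc n"
  shows "(\<lambda>n. real (f n)) \<sim>[at_top] (\<lambda>n. real n)"
proof (rule asymp_equiv_sandwich_real)
  show "(\<lambda>n. real n - 2) \<sim>[at_top] (\<lambda>n. real n)" "(\<lambda>n. real n + 1) \<sim>[at_top] (\<lambda>n. real n)"
    by real_asymp+
  have "real n - 2 \<le> real (f n) \<and> real (f n) \<le> real n + 1" for n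
    using assms[of n] by linarith
  then show "\<forall>\<^sub>F n in at_top. real (f n) \<in> {real n - 2..real n + 1}"
    by simp
qed

lemma max_pattern_size_Star_Zero_Star_asymp:
  "(\<lambda>n. real (max_pattern_size [Star, Zero, Star] n)) \<sim>[at_top] (\<lambda>n. real n)"
proof (rule asymp_equiv_identity)
  fix n :: nat
  show "n \<le> max_pattern_size [Star, Zero, Star] n + 2"
  proof (cases "n \<ge> 2")
    case True
    define m where "m = 3 * ((n - 2) div 3) + 2"
    have "m \<le> n" "n \<le> m + 2" "m mod 3 = 2"
      using True unfolding m_def by presburger+
    moreover have "m \<le> max_pattern_size [Star, Zero, Star] n"
      using calculation by (intro max_pattern_size_point_complements[of _ 0]) (simp_all, presburger+)
    ultimately show ?thesis
      by simp
  qed simp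
  show "max_pattern_size [Star, Zero, Star] n \<le> Suc n"
    using max_pattern_size_Star_Zero_le le_SucI by blast
qed

lemma max_pattern_size_Star_Star_Zero_asymp:
  "(\<lambda>n. real (max_pattern_size [Star, Star, Zero] n)) \<sim>[at_top] (\<lambda>n. real n)"
proof (rule asymp_equiv_identity)
  fix n :: nat
  define m where "m = 3 * (n div 3)"
  have "m \<le> n" "n \<le> m + 2" "m mod 3 = 0"
    unfolding m_def by presburger+
  moreover have "m \<le> max_pattern_size [Star, Star, Zero] n"
    using calculation by (intro max_pattern_size_point_complements[of _ 0]) (simp_all, presburger+)
  ultimately show "n \<le> max_pattern_size [Star, Star, Zero] n + 2"
    by simp
  show "max_pattern_size [Star, Star, Zero] n \<le> Suc n"
    by (rule max_pattern_size_traces_Star_Zero_le)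
qed

lemma max_pattern_size_Zero_Star_Star_asymp:
  "(\<lambda>n. real (max_pattern_size [Zero, Star, Star] n)) \<sim>[at_top] (\<lambda>n. real n ^ 2 / 2)"
proof (rule asymp_equiv_sandwich_real)
  have two: "real (k choose 2) = real k * (real k - 1) / 2" for k
    by (cases k) (simp_all add: choose_two real_of_nat_div field_simps)
  show "(\<lambda>n. (real n - 1) * (real n - 2) / 2) \<sim>[at_top] (\<lambda>n. real n ^ 2 / 2)"
    "(\<lambda>n. 1 + real n + real n * (real n - 1) / 2) \<sim>[at_top] (\<lambda>n. real n ^ 2 / 2)"
    by real_asymp+
  show "\<forall>\<^sub>F n in at_top. real (max_pattern_size [Zero, Star, Star] n) \<in>
      {(real n - 1) * (real n - 2) / 2..1 + real n + real n * (real n - 1) / 2}"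
    using eventually_ge_at_top[of 1]
  proof eventually_elim
    case (elim n)
    then have "(real n - 1) * (real n - 2) / 2 = real ((n - 1) choose 2)"
      by (simp add: two of_nat_diff)
    also have "\<dots> \<le> real (max_pattern_size [Zero, Star, Star] n)"
      using max_pattern_size_triples_through_point by (simp only: of_nat_le_iff)
    finally have "(real n - 1) * (real n - 2) / 2 \<le> real (max_pattern_size [Zero, Star, Star] n)" .
    moreover have "real (max_pattern_size [Zero, Star, Star] n) \<le> real (1 + n + (n choose 2))"
      using max_pattern_size_Zero_Star_le by (simp only: of_nat_le_iff)
    ultimately show ?case
      by (simp add: two)
  qed
qed

lemma max_pattern_size_Zero_Star_Zero_linear:
  "(\<lambda>n. real (max_pattern_size [Zero, Star, Zero] n)) \<in> \<Theta>[all_pos](\<lambda>n. real n)"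
proof -
  have upper: "real (max_pattern_size [Zero, Star, Zero] n) \<le> 2 * real n" if "n \<ge> 1" for n
    using max_pattern_size_traces_Star_Zero_le[of Zero n] that by linarith
  have lower: "real n \<le> 7 * real (max_pattern_size [Zero, Star, Zero] n)" for n
  proof -
    define m where "m = 3 * (n div 6)"
    have "m * 2 \<le> n" "n \<le> 2 * m + 5" "m mod 3 = 0"
      unfolding m_def by presburger+
    moreover have "m \<le> max_pattern_size [Zero, Star, Zero] n"
      using calculation
      by (intro max_pattern_size_point_complements[of _ 1]) (simp_all, presburger+)
    ultimately show ?thesis
      using max_pattern_size_Zero_pos[of Star Zero n] by linarith
  qed
  show ?thesis
    using upper lower
    by (intro bigthetaI, unfold bigomega_iff_bigo)
       (intro bigoI[of _ 2] bigoI[of _ 7]; simp add: eventually_principal)+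
qed

lemma max_pattern_size_Zero_Zero_Star_bounds:
  "(\<lambda>n. real (max_pattern_size [Zero, Zero, Star] n)) \<in> \<Omega>[all_pos](\<lambda>n. real n)"
  "(\<lambda>n. real (max_pattern_size [Zero, Zero, Star] n)) \<in> O[all_pos](\<lambda>n. real n ^ 2)"
proof -
  have "n \<le> 11 * max_pattern_size [Zero, Zero, Star] n" for n
  proof (cases "n \<ge> 6")
    case True
    define m where "m = 3 * ((n - 6) div 9) + 2"
    have "m * 3 \<le> n" "n \<le> 3 * m + 8" "m mod 3 = 2"
      using True unfolding m_def by presburger+
    moreover have "m \<le> max_pattern_size [Zero, Zero, Star] n"
      using calculation
      by (intro max_pattern_size_point_complements[of _ 2]) (simp_all, presburger+)
    ultimately show ?thesis
      using max_pattern_size_Zero_pos[of Zero Star n] by linarith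
  qed (use max_pattern_size_Zero_pos[of Zero Star n] in linarith)
  then have "real n \<le> real (11 * max_pattern_size [Zero, Zero, Star] n)" for n
    by (simp only: of_nat_le_iff)
  then show "(\<lambda>n. real (max_pattern_size [Zero, Zero, Star] n)) \<in> \<Omega>[all_pos](\<lambda>n. real n)"
    unfolding bigomega_iff_bigo by (intro bigoI[of _ 11]) simp
  have "max_pattern_size [Zero, Zero, Star] n \<le> 4 * n ^ 2" if "n \<ge> 1" for n
  proof -
    have "n choose 2 \<le> n ^ 2"
      unfolding choose_two power2_eq_square by (rule le_trans[OF div_le_dividend]) simp
    moreover have "n \<le> n ^ 2" "1 \<le> n ^ 2"
      using that by (auto simp: power2_eq_square)
    ultimately show ?thesis
      using max_pattern_size_traces_Zero_Star_le[of Zero n] by linarith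
  qed
  then have "real (max_pattern_size [Zero, Zero, Star] n) \<le> real (4 * n ^ 2)" if "n \<ge> 1" for n
    using that by (simp only: of_nat_le_iff)
  then show "(\<lambda>n. real (max_pattern_size [Zero, Zero, Star] n)) \<in> O[all_pos](\<lambda>n. real n ^ 2)"
    by (intro bigoI[of _ 4]) (simp add: eventually_principal)
qed

theorem mainTheorem6:
  "(\<forall>n. max_pattern_size [Star, Zero, Zero] n = n) \<and>
   (\<lambda>n. real (max_pattern_size [Zero, Star, Star] n)) \<sim>[at_top] (\<lambda>n. real n ^ 2 / 2) \<and>
   (\<lambda>n. real (max_pattern_size [Star, Zero, Star] n)) \<sim>[at_top] (\<lambda>n. real n) \<and>
   (\<lambda>n. real (max_pattern_size [Zero, Star, Zero] n)) \<in> \<Theta>[all_pos](\<lambda>n. real n) \<and>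
   (\<lambda>n. real (max_pattern_size [Star, Star, Zero] n)) \<sim>[at_top] (\<lambda>n. real n) \<and>
   ((\<lambda>n. real (max_pattern_size [Zero, Zero, Star] n)) \<in> \<Omega>[all_pos](\<lambda>n. real n) \<and>
    (\<lambda>n. real (max_pattern_size [Zero, Zero, Star] n)) \<in> O[all_pos](\<lambda>n. real n ^ 2)) \<and>
   (\<exists>c::real. c > 1 \<and>
      (\<lambda>n. real (max_pattern_size [Zero, Zero, Zero] n)) \<in> \<Omega>[all_pos](\<lambda>n. c ^ n)) \<and>
   (\<exists>c::real. c > 1 \<and>
      (\<lambda>n. real (max_pattern_size [Star, Star, Star] n)) \<in> \<Omega>[all_pos](\<lambda>n. c ^ n))"
proof (intro conjI allI)
  show "max_pattern_size [Star, Zero, Zero] n = n" for n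
    by (rule antisym[OF max_pattern_size_Star_Zero_le max_pattern_size_singletons])
  show "\<exists>c::real. c > 1 \<and>
      (\<lambda>n. real (max_pattern_size [Zero, Zero, Zero] n)) \<in> \<Omega>[all_pos](\<lambda>n. c ^ n)"
    by (rule max_pattern_size_constant_exponential[of 0]) simp_all
  show "\<exists>c::real. c > 1 \<and>
      (\<lambda>n. real (max_pattern_size [Star, Star, Star] n)) \<in> \<Omega>[all_pos](\<lambda>n. c ^ n)"
    by (rule max_pattern_size_constant_exponential[of 1]) simp_all
qed (rule max_pattern_size_Zero_Star_Star_asymp max_pattern_size_Star_Zero_Star_asymp
      max_pattern_size_Zero_Star_Zero_linear max_pattern_size_Star_Star_Zero_asymp
      max_pattern_size_Zero_Zero_Star_bounds)+

end
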